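(* Let $(\mathcal S,\mathcal A,P,R,\gamma)$ be a finite MDP with bisimulation metric $d$, let $\mathcal C$ be a fixed set of unordered pairs of distinct states, and let $d_0$ be a pair function with $0\le d_0\le d$ that is a sub-solution on $\mathcal C$, i.e. $Td_0\ge d_0$ on $\mathcal C$ (for instance $d_0=0$ or $d_0=d_R$). Let $\hat d$ be the limit of the exact restricted iteration $f_0=d_0$, $f_{t+1}=Tf_t$ on $\mathcal C$, $f_{t+1}=d_0$ off $\mathcal C$ (equivalently, the unique pair function with $\hat d=T\hat d$ on $\mathcal C$ and $\hat d=d_0$ off $\mathcal C$). Then $$\|\hat d-d\|_\infty=\rho,\qquad \rho:=\max_{p\notin\mathcal C}\big(d(p)-d_0(p)\big).$$
   Context: The MDP has finite $\mathcal S$, finite nonempty $\mathcal A$, transition kernel $P(\cdot\mid s,a)$, reward $R:\mathcal S\times\mathcal A\to[0,L]$, and $\gamma\in[0,1)$. A pair function is a real symmetric function on $\mathcal S\times\mathcal S$ vanishing on the diagonal, regarded as a function on unordered pairs of distinct states; $\|f\|_\infty=\max_{s,s'}|f(s,s')|$, and inequalities are pointwise. For a pair function $f$ and distributions $\mu,\nu$ on $\mathcal S$, $W_1^f(\mu,\nu)=\min_\pi\sum_{x,y}f(x,y)\pi(x,y)$ over couplings $\pi$ of $\mu,\nu$. For $s\neq s'$, $$(Tf)(s,s')=\max_{a\in\mathcal A}\big[|R(s,a)-R(s',a)|+\gamma W_1^f(P(\cdot\mid s,a),P(\cdot\mid s',a))\big].$$ $T$ is a $\gamma$-contraction in $\|\cdot\|_\infty$;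 the bisimulation metric $d$ is its unique fixed point. $d_R(s,s'):=\max_a|R(s,a)-R(s',a)|$. Pairs "off $\mathcal C$" (written $p\notin\mathcal C$) are unordered pairs of distinct states not in $\mathcal C$. A maximum over an empty set is $0$. *)

theory Defs
  imports "HOL-Probability.Probability"
begin

text \<open>
  A finite MDP is given by finite types \<open>'s\<close> (states) and \<open>'a\<close> (actions), a transition kernel
  \<open>P :: 's \<Rightarrow> 'a \<Rightarrow> 's pmf\<close>, a reward \<open>R :: 's \<Rightarrow> 'a \<Rightarrow> real\<close> and a discount \<open>\<gamma>\<close>.
\<close>

definition is_mdp :: "('s::finite \<Rightarrow> 'a::finite \<Rightarrow> real) \<Rightarrow> real \<Rightarrow> real \<Rightarrow> bool" where
  "is_mdp R L \<gamma> \<longleftrightarrow> (\<forall>s a. 0 \<le> R s a \<and> R s a \<le> L) \<and> 0 \<le> \<gamma> \<and> \<gamma> < 1"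

definition pair_function :: "('s \<Rightarrow> 's \<Rightarrow> real) \<Rightarrow> bool" where
  "pair_function f \<longleftrightarrow> (\<forall>s s'. f s s' = f s' s) \<and> (\<forall>s. f s s = 0)"

definition state_pairs :: "'s set set" where
  "state_pairs = {{s, s'} | s s'. s \<noteq> s'}"

definition sup_norm :: "('s::finite \<Rightarrow> 's \<Rightarrow> real) \<Rightarrow> real" where
  "sup_norm f = Max {\<bar>f s s'\<bar> | s s'. True}"

definition couplings :: "'s pmf \<Rightarrow> 's pmf \<Rightarrow> ('s \<times> 's) pmf set" where
  "couplings \<mu> \<nu> = {\<pi>. map_pmf fst \<pi> = \<mu> \<and> map_pmf snd \<pi> = \<nu>}"

definition transport_cost :: "('s::finite \<Rightarrow> 's \<Rightarrow> real) \<Rightarrow> ('s \<times> 's) pmf \<Rightarrow> real" where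
  "transport_cost f \<pi> = (\<Sum>x\<in>UNIV. \<Sum>y\<in>UNIV. f x y * pmf \<pi> (x, y))"

text \<open>The infimum is a minimum; see \<open>W1_attained\<close> and \<open>W1_le\<close> below.\<close>

definition W1 :: "('s::finite \<Rightarrow> 's \<Rightarrow> real) \<Rightarrow> 's pmf \<Rightarrow> 's pmf \<Rightarrow> real" where
  "W1 f \<mu> \<nu> = (INF \<pi>\<in>couplings \<mu> \<nu>. transport_cost f \<pi>)"

definition bisim_op ::
  "('s::finite \<Rightarrow> 'a::finite \<Rightarrow> 's pmf) \<Rightarrow> ('s \<Rightarrow> 'a \<Rightarrow> real) \<Rightarrow> real
    \<Rightarrow> ('s \<Rightarrow> 's \<Rightarrow> real) \<Rightarrow> 's \<Rightarrow> 's \<Rightarrow> real" where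
  "bisim_op P R \<gamma> f s s' =
     (if s = s' then 0
      else Max (range (\<lambda>a. \<bar>R s a - R s' a\<bar> + \<gamma> * W1 f (P s a) (P s' a))))"

definition bisim_metric ::
  "('s::finite \<Rightarrow> 'a::finite \<Rightarrow> 's pmf) \<Rightarrow> ('s \<Rightarrow> 'a \<Rightarrow> real) \<Rightarrow> real \<Rightarrow> 's \<Rightarrow> 's \<Rightarrow> real" where
  "bisim_metric P R \<gamma> = (THE d. pair_function d \<and> bisim_op P R \<gamma> d = d)"

definition reward_metric :: "('s \<Rightarrow> 'a::finite \<Rightarrow> real) \<Rightarrow> 's \<Rightarrow> 's \<Rightarrow> real" where
  "reward_metric R s s' = Max (range (\<lambda>a. \<bar>R s a - R s' a\<bar>))"

definition admissible_start ::
  "('s::finite \<Rightarrow> 'a::finite \<Rightarrow> 's pmf) \<Rightarrow> ('s \<Rightarrow> 'a \<Rightarrow> real) \<Rightarrow> real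
    \<Rightarrow> 's set set \<Rightarrow> ('s \<Rightarrow> 's \<Rightarrow> real) \<Rightarrow> bool" where
  "admissible_start P R \<gamma> C d0 \<longleftrightarrow>
     pair_function d0 \<and>
     (\<forall>s s'. 0 \<le> d0 s s' \<and> d0 s s' \<le> bisim_metric P R \<gamma> s s') \<and>
     (\<forall>s s'. {s, s'} \<in> C \<longrightarrow> d0 s s' \<le> bisim_op P R \<gamma> d0 s s')"

primrec restricted_iter ::
  "('s::finite \<Rightarrow> 'a::finite \<Rightarrow> 's pmf) \<Rightarrow> ('s \<Rightarrow> 'a \<Rightarrow> real) \<Rightarrow> real
    \<Rightarrow> 's set set \<Rightarrow> ('s \<Rightarrow> 's \<Rightarrow> real) \<Rightarrow> nat \<Rightarrow> 's \<Rightarrow> 's \<Rightarrow> real" where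
  "restricted_iter P R \<gamma> C d0 0 = d0"
| "restricted_iter P R \<gamma> C d0 (Suc t) =
     (\<lambda>s s'. if {s, s'} \<in> C then bisim_op P R \<gamma> (restricted_iter P R \<gamma> C d0 t) s s'
             else d0 s s')"

definition restricted_limit ::
  "('s::finite \<Rightarrow> 'a::finite \<Rightarrow> 's pmf) \<Rightarrow> ('s \<Rightarrow> 'a \<Rightarrow> real) \<Rightarrow> real
    \<Rightarrow> 's set set \<Rightarrow> ('s \<Rightarrow> 's \<Rightarrow> real) \<Rightarrow> 's \<Rightarrow> 's \<Rightarrow> real" where
  "restricted_limit P R \<gamma> C d0 s s' = lim (\<lambda>t. restricted_iter P R \<gamma> C d0 t s s')"

definition restricted_solution ::
  "('s::finite \<Rightarrow> 'a::finite \<Rightarrow> 's pmf) \<Rightarrow> ('s \<Rightarrow> 'a \<Rightarrow> real) \<Rightarrow> real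
    \<Rightarrow> 's set set \<Rightarrow> ('s \<Rightarrow> 's \<Rightarrow> real) \<Rightarrow> ('s \<Rightarrow> 's \<Rightarrow> real) \<Rightarrow> bool" where
  "restricted_solution P R \<gamma> C d0 g \<longleftrightarrow>
     pair_function g \<and>
     (\<forall>s s'. {s, s'} \<in> C \<longrightarrow> g s s' = bisim_op P R \<gamma> g s s') \<and>
     (\<forall>s s'. {s, s'} \<notin> C \<longrightarrow> g s s' = d0 s s')"

definition max_gap_off ::
  "'s::finite set set \<Rightarrow> ('s \<Rightarrow> 's \<Rightarrow> real) \<Rightarrow> ('s \<Rightarrow> 's \<Rightarrow> real) \<Rightarrow> real" where
  "max_gap_off C d d0 =
     (let G = {d s s' - d0 s s' | s s'. s \<noteq> s' \<and> {s, s'} \<notin> C}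
      in if G = {} then 0 else Max G)"

lemma couplings_nonempty: "couplings \<mu> \<nu> \<noteq> {}"
  using map_fst_pair_pmf[of \<mu> \<nu>] map_snd_pair_pmf[of \<mu> \<nu>] unfolding couplings_def by blast

lemma pmf_map_fst_finite:
  fixes \<pi> :: "('s::finite \<times> 's) pmf"
  shows "pmf (map_pmf fst \<pi>) x = (\<Sum>y\<in>UNIV. pmf \<pi> (x, y))"
proof -
  have "fst -` {x} = (Pair x) ` (UNIV :: 's set)" by auto
  then show ?thesis
    by (simp add: pmf_map measure_measure_pmf_finite sum.reindex inj_on_def)
qed

lemma pmf_map_snd_finite:
  fixes \<pi> :: "('s::finite \<times> 's) pmf"
  shows "pmf (map_pmf snd \<pi>) y = (\<Sum>x\<in>UNIV. pmf \<pi> (x, y))"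
proof -
  have "snd -` {y} = (\<lambda>x. (x, y)) ` (UNIV :: 's set)" by auto
  then show ?thesis
    by (simp add: pmf_map measure_measure_pmf_finite sum.reindex inj_on_def)
qed

lemma ex_min_coupling:
  fixes f :: "'s::finite \<Rightarrow> 's \<Rightarrow> real"
  shows "\<exists>\<pi>\<in>couplings \<mu> \<nu>. \<forall>\<pi>'\<in>couplings \<mu> \<nu>. transport_cost f \<pi> \<le> transport_cost f \<pi>'"
proof -
  define K :: "(real ^ ('s \<times> 's)) set" where
    "K = {v. (\<forall>p. 0 \<le> v $ p) \<and> (\<forall>x. (\<Sum>y\<in>UNIV. v $ (x, y)) = pmf \<mu> x) \<and>
             (\<forall>y. (\<Sum>x\<in>UNIV. v $ (x, y)) = pmf \<nu> y)}"
  define vec where "vec \<pi> = (\<chi> p. pmf \<pi> p)" for \<pi> :: "('s \<times> 's) pmf"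
  define c where "c v = (\<Sum>x\<in>UNIV. \<Sum>y\<in>UNIV. f x y * v $ (x, y))" for v :: "real ^ ('s \<times> 's)"
  have vecK: "vec \<pi> \<in> K" if "\<pi> \<in> couplings \<mu> \<nu>" for \<pi>
    using that pmf_map_fst_finite[of \<pi>] pmf_map_snd_finite[of \<pi>]
    by (auto simp: K_def vec_def couplings_def)
  have cvec: "c (vec \<pi>) = transport_cost f \<pi>" for \<pi>
    by (simp add: c_def vec_def transport_cost_def)
  have surj: "\<exists>\<pi>\<in>couplings \<mu> \<nu>. vec \<pi> = v" if v: "v \<in> K" for v
  proof -
    have nn: "0 \<le> v $ p" for p using v unfolding K_def by blast
    have "(\<Sum>p\<in>UNIV. v $ p) = (\<Sum>x\<in>UNIV. \<Sum>y\<in>UNIV. v $ (x, y))"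
      by (simp add: sum.cartesian_product)
    also have "\<dots> = (\<Sum>x\<in>UNIV. pmf \<mu> x)" using v by (simp add: K_def)
    also have "\<dots> = 1" by (rule sum_pmf_eq_1) auto
    finally have "(\<integral>\<^sup>+p. ennreal (v $ p) \<partial>count_space UNIV) = 1"
      using nn by (simp add: nn_integral_count_space_finite)
    then have pmf: "pmf (embed_pmf (\<lambda>p. v $ p)) p = v $ p" for p
      using nn by (simp add: pmf_embed_pmf)
    let ?\<pi> = "embed_pmf (\<lambda>p. v $ p)"
    have "?\<pi> \<in> couplings \<mu> \<nu>"
      using v unfolding couplings_def K_def
      by (auto intro!: pmf_eqI simp: pmf_map_fst_finite pmf_map_snd_finite pmf)
    moreover have "vec ?\<pi> = v" by (simp add: vec_def pmf vec_eq_iff)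
    ultimately show ?thesis by blast
  qed
  have "K = {v. \<forall>p. 0 \<le> v $ p} \<inter> {v. \<forall>x. (\<Sum>y\<in>UNIV. v $ (x, y)) = pmf \<mu> x} \<inter>
            {v. \<forall>y. (\<Sum>x\<in>UNIV. v $ (x, y)) = pmf \<nu> y}"
    by (auto simp: K_def)
  moreover have "closed \<dots>"
    by (intro closed_Int closed_Collect_all closed_Collect_le closed_Collect_eq continuous_intros)
  ultimately have "closed K" by simp
  moreover have "K \<subseteq> cbox 0 1"
  proof
    fix v assume "v \<in> K"
    then obtain \<pi> where "v = vec \<pi>" using surj by blast
    then show "v \<in> cbox 0 1" by (simp add: mem_box_cart vec_def pmf_le_1)
  qed
  then have "bounded K" using bounded_cbox bounded_subset by blast
  ultimately have "compact K" by (simp add: compact_eq_bounded_closed)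
  moreover have "K \<noteq> {}" using couplings_nonempty vecK by blast
  moreover have "continuous_on K c" unfolding c_def by (intro continuous_intros)
  ultimately obtain v where "v \<in> K" "\<forall>w\<in>K. c v \<le> c w"
    using continuous_attains_inf by blast
  moreover obtain \<pi> where "\<pi> \<in> couplings \<mu> \<nu>" "vec \<pi> = v" using surj calculation by blast
  ultimately show ?thesis using vecK cvec by metis
qed

lemma bdd_below_cost: "bdd_below (transport_cost f ` couplings \<mu> \<nu>)"
  using ex_min_coupling[of \<mu> \<nu> f] unfolding bdd_below_def by blast

lemma W1_le: "\<pi> \<in> couplings \<mu> \<nu> \<Longrightarrow> W1 f \<mu> \<nu> \<le> transport_cost f \<pi>"
  unfolding W1_def by (rule cINF_lower[OF bdd_below_cost])

lemma W1_attained: "\<exists>\<pi>\<in>couplings \<mu> \<nu>. W1 f \<mu> \<nu> = transport_cost f \<pi>"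
proof -
  obtain \<pi> where \<pi>: "\<pi> \<in> couplings \<mu> \<nu>"
    "\<forall>\<pi>'\<in>couplings \<mu> \<nu>. transport_cost f \<pi> \<le> transport_cost f \<pi>'"
    using ex_min_coupling by blast
  then have "transport_cost f \<pi> \<le> W1 f \<mu> \<nu>"
    unfolding W1_def by (intro cINF_greatest couplings_nonempty) auto
  with \<pi> W1_le show ?thesis by (metis order_antisym)
qed

end

theory Submission
  imports Defs
begin

text \<open>
  The restricted operator (\<open>T\<close> on \<open>C\<close>, the constant \<open>d0\<close> off \<open>C\<close>) is a
  \<open>\<gamma>\<close>-contraction like \<open>T\<close> itself, so its iterates converge to its unique fixed point. Let \<open>M\<close> be
  the distance of that fixed point from \<open>d\<close>. On \<open>C\<close> both functions are fixed by \<open>T\<close>, so the gap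
  is at most \<open>\<gamma> * M\<close> there; off \<open>C\<close> the gap is \<open>d - d0 \<le> \<rho>\<close>. Hence \<open>M \<le> max \<rho> (\<gamma> * M)\<close>, which
  forces \<open>M \<le> \<rho>\<close>, and \<open>\<rho>\<close> is attained off \<open>C\<close>.
\<close>

section \<open>The sup norm on functions of two states\<close>

lemma sup_norm_set: "{\<bar>f s s'\<bar> | s s'. True} = (\<lambda>(s, s'). \<bar>f s s'\<bar>) ` UNIV"
  by auto

lemma abs_le_sup_norm: "\<bar>f s s'\<bar> \<le> sup_norm f"
  unfolding sup_norm_def sup_norm_set by (rule Max_ge) auto

lemma sup_norm_le: "(\<And>s s'. \<bar>f s s'\<bar> \<le> B) \<Longrightarrow> sup_norm f \<le> B"
  unfolding sup_norm_def sup_norm_set by (subst Max_le_iff) auto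

lemma sup_norm_nonneg: "0 \<le> sup_norm f"
  using abs_le_sup_norm[of f undefined undefined] by linarith

section \<open>Contractions and their fixed points\<close>

text \<open>Quantifies over all functions, not only pair functions, so that uniqueness of fixed
  points can later be used to prove symmetry.\<close>

definition contracting :: "real \<Rightarrow> (('s::finite \<Rightarrow> 's \<Rightarrow> real) \<Rightarrow> 's \<Rightarrow> 's \<Rightarrow> real) \<Rightarrow> bool" where
  "contracting \<gamma> G \<longleftrightarrow>
     (\<forall>f g s s'. \<bar>G f s s' - G g s s'\<bar> \<le> \<gamma> * sup_norm (\<lambda>x y. f x y - g x y))"

lemma contractingD:
  "contracting \<gamma> G \<Longrightarrow> \<bar>G f s s' - G g s s'\<bar> \<le> \<gamma> * sup_norm (\<lambda>x y. f x y - g x y)"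
  unfolding contracting_def by blast

lemma contracting_fixpoint_unique:
  assumes G: "contracting \<gamma> G" and \<gamma>: "\<gamma> < 1" and "G f = f" "G g = g"
  shows "f = g"
proof -
  let ?M = "sup_norm (\<lambda>x y. f x y - g x y)"
  have "?M \<le> \<gamma> * ?M"
    using contractingD[OF G, of f _ _ g] assms by (intro sup_norm_le) simp
  then have "?M * (1 - \<gamma>) \<le> 0" by (simp add: algebra_simps)
  then have "?M \<le> 0" using \<gamma> by (simp add: mult_le_0_iff)
  then have "\<bar>f x y - g x y\<bar> \<le> 0" for x y
    using abs_le_sup_norm[of "\<lambda>x y. f x y - g x y" x y] by linarith
  then show ?thesis by (intro ext) simp
qed

text \<open>Banach's argument in each coordinate: successive differences are at most
  \<open>K * \<gamma> ^ t\<close>, so their telescoping series converges. Convergence is kept in the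
  conclusion because \<open>restricted_limit\<close> is defined by \<open>lim\<close>.\<close>

lemma contracting_iterates_converge:
  assumes G: "contracting \<gamma> G" and \<gamma>: "0 \<le> \<gamma>" "\<gamma> < 1" and step: "\<And>t. f (Suc t) = G (f t)"
  shows "\<exists>g. G g = g \<and> (\<forall>x y. (\<lambda>t. f t x y) \<longlonglongrightarrow> g x y)"
proof -
  define K where "K = sup_norm (\<lambda>x y. f (Suc 0) x y - f 0 x y)"
  have diff: "sup_norm (\<lambda>x y. f (Suc t) x y - f t x y) \<le> K * \<gamma> ^ t" for t
  proof (induction t)
    case (Suc t)
    have "sup_norm (\<lambda>x y. f (Suc (Suc t)) x y - f (Suc t) x y)
        \<le> \<gamma> * sup_norm (\<lambda>x y. f (Suc t) x y - f t x y)"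
      using contractingD[OF G, of "f (Suc t)" _ _ "f t"] by (intro sup_norm_le) (simp only: step)
    also have "\<dots> \<le> \<gamma> * (K * \<gamma> ^ t)" using Suc \<gamma>(1) by (rule mult_left_mono)
    finally show ?case by (simp add: mult_ac)
  qed (simp add: K_def)
  have conv: "convergent (\<lambda>t. f t x y)" for x y
  proof -
    have "summable (\<lambda>t. K * \<gamma> ^ t)" using \<gamma> by (intro summable_mult summable_geometric) simp
    moreover have "norm (f (Suc t) x y - f t x y) \<le> K * \<gamma> ^ t" for t
      using order_trans[OF abs_le_sup_norm diff] by fastforce
    ultimately have "summable (\<lambda>t. f (Suc t) x y - f t x y)"
      by (rule summable_comparison_test'[where N = 0])
    then have "convergent (\<lambda>n. \<Sum>t<n. f (Suc t) x y - f t x y)"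
      by (simp add: summable_iff_convergent)
    then have "convergent (\<lambda>n. f n x y - f 0 x y)"
      by (simp add: sum_lessThan_telescope[of "\<lambda>t. f t x y"])
    then have "convergent (\<lambda>n. (f n x y - f 0 x y) + f 0 x y)"
      by (intro convergent_add convergent_const)
    then show ?thesis by simp
  qed
  define g where "g x y = lim (\<lambda>t. f t x y)" for x y
  have lim: "(\<lambda>t. f t x y) \<longlonglongrightarrow> g x y" for x y
    using conv by (simp add: g_def convergent_LIMSEQ_iff)
  \<comment> \<open>With finitely many states, pointwise convergence gives convergence in the sup
    norm, which is dominated by this finite sum.\<close>
  have sum0: "(\<lambda>t. \<Sum>x\<in>UNIV. \<Sum>y\<in>UNIV. \<bar>f t x y - g x y\<bar>) \<longlonglongrightarrow> 0"
    using lim by (intro tendsto_null_sum tendsto_rabs_zero) (simp add: LIM_zero)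
  have "sup_norm (\<lambda>x y. f t x y - g x y) \<le> (\<Sum>x\<in>UNIV. \<Sum>y\<in>UNIV. \<bar>f t x y - g x y\<bar>)" for t
  proof (rule sup_norm_le)
    fix x y
    have "\<bar>f t x y - g x y\<bar> \<le> (\<Sum>y\<in>UNIV. \<bar>f t x y - g x y\<bar>)"
      by (rule member_le_sum) auto
    also have "\<dots> \<le> (\<Sum>x\<in>UNIV. \<Sum>y\<in>UNIV. \<bar>f t x y - g x y\<bar>)"
      by (rule member_le_sum) (auto intro: sum_nonneg)
    finally show "\<bar>f t x y - g x y\<bar> \<le> \<dots>" .
  qed
  then have "(\<lambda>t. sup_norm (\<lambda>x y. f t x y - g x y)) \<longlonglongrightarrow> 0"
    by (intro tendsto_sandwich[OF _ _ tendsto_const sum0]) (auto simp: sup_norm_nonneg)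
  then have norm0: "(\<lambda>t. \<gamma> * sup_norm (\<lambda>x y. f t x y - g x y)) \<longlonglongrightarrow> 0"
    by (rule tendsto_mult_right_zero)
  \<comment> \<open>The shifted sequence \<open>f (Suc t) = G (f t)\<close> tends to
    \<open>G g\<close> by contraction and to \<open>g\<close> as a shift of
    \<open>f\<close>.\<close>
  have "G g x y = g x y" for x y
  proof -
    have "(\<lambda>t. f (Suc t) x y - G g x y) \<longlonglongrightarrow> 0"
      using contractingD[OF G] by (intro Lim_null_comparison[OF _ norm0]) (simp add: step)
    then have "(\<lambda>t. f (Suc t) x y) \<longlonglongrightarrow> G g x y" by (rule LIM_zero_cancel)
    moreover have "(\<lambda>t. f (Suc t) x y) \<longlonglongrightarrow> g x y" using lim by (rule LIMSEQ_Suc)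
    ultimately show ?thesis by (rule LIMSEQ_unique)
  qed
  with lim show ?thesis by blast
qed

section \<open>The transport cost \<open>W1\<close>\<close>

text \<open>An optimal coupling for \<open>g\<close> is a competitor for \<open>f\<close>, and it
  has total mass 1, so the constant \<open>B\<close> is paid exactly once.\<close>

lemma W1_le_add:
  assumes "\<And>x y. f x y \<le> g x y + B"
  shows "W1 f \<mu> \<nu> \<le> W1 g \<mu> \<nu> + B"
proof -
  obtain \<pi> where \<pi>: "\<pi> \<in> couplings \<mu> \<nu>" "W1 g \<mu> \<nu> = transport_cost g \<pi>"
    using W1_attained by blast
  have one: "(\<Sum>x\<in>UNIV. \<Sum>y\<in>UNIV. pmf \<pi> (x, y)) = 1"
    by (simp add: sum.cartesian_product sum_pmf_eq_1)
  have "W1 f \<mu> \<nu> \<le> transport_cost f \<pi>" using \<pi>(1) by (rule W1_le)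
  also have "\<dots> \<le> (\<Sum>x\<in>UNIV. \<Sum>y\<in>UNIV. (g x y + B) * pmf \<pi> (x, y))"
    unfolding transport_cost_def using assms by (intro sum_mono mult_right_mono) auto
  also have "\<dots> = transport_cost g \<pi> + B * (\<Sum>x\<in>UNIV. \<Sum>y\<in>UNIV. pmf \<pi> (x, y))"
    by (simp add: transport_cost_def distrib_right sum.distrib sum_distrib_left)
  finally show ?thesis using \<pi>(2) one by simp
qed

lemma W1_zero: "W1 (\<lambda>x y. 0) \<mu> \<nu> = 0"
  using W1_attained[of \<mu> \<nu> "\<lambda>x y. 0"] by (auto simp: transport_cost_def)

text \<open>Swapping the coordinates of an optimal coupling preserves its cost. Flipping is an
  involution, so applying this bound twice yields equality.\<close>

lemma W1_flip_le: "W1 (\<lambda>x y. f y x) \<nu> \<mu> \<le> W1 f \<mu> \<nu>"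
proof -
  obtain \<pi> where \<pi>: "\<pi> \<in> couplings \<mu> \<nu>" "W1 f \<mu> \<nu> = transport_cost f \<pi>"
    using W1_attained by blast
  let ?\<pi> = "map_pmf prod.swap \<pi>"
  have "?\<pi> \<in> couplings \<nu> \<mu>"
    using \<pi>(1) by (auto simp: couplings_def pmf.map_comp comp_def)
  moreover have "pmf ?\<pi> (y, x) = pmf \<pi> (x, y)" for x y
    using pmf_map_inj'[of prod.swap \<pi> "(x, y)"] by simp
  then have "transport_cost (\<lambda>x y. f y x) ?\<pi> = transport_cost f \<pi>"
    unfolding transport_cost_def by (subst sum.swap) simp
  ultimately show ?thesis using W1_le \<pi>(2) by metis
qed

lemma W1_flip: "W1 (\<lambda>x y. f y x) \<nu> \<mu> = W1 f \<mu> \<nu>"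
  using W1_flip_le[of f \<nu> \<mu>] W1_flip_le[of "\<lambda>x y. f y x" \<mu> \<nu>] by (intro antisym)

section \<open>The bisimulation operator\<close>

text \<open>Common source of monotonicity (\<open>B = 0\<close>) and contraction (\<open>B\<close>
  the sup norm of the difference, in both directions). On the diagonal both operator values are 0
  and \<open>0 \<le> B\<close> closes the case.\<close>

lemma bisim_op_le_add:
  assumes "0 \<le> \<gamma>" "0 \<le> B" "\<And>x y. f x y \<le> g x y + B"
  shows "bisim_op P R \<gamma> f s s' \<le> bisim_op P R \<gamma> g s s' + \<gamma> * B"
proof (cases "s = s'")
  case False
  let ?h = "\<lambda>f a. \<bar>R s a - R s' a\<bar> + \<gamma> * W1 f (P s a) (P s' a)"
  have "?h f a \<le> Max (range (?h g)) + \<gamma> * B" for a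
  proof -
    have "\<gamma> * W1 f (P s a) (P s' a) \<le> \<gamma> * (W1 g (P s a) (P s' a) + B)"
      using assms by (intro mult_left_mono W1_le_add)
    moreover have "?h g a \<le> Max (range (?h g))" by (rule Max_ge) auto
    ultimately show ?thesis by (simp only: distrib_left)
  qed
  then have "Max (range (?h f)) \<le> Max (range (?h g)) + \<gamma> * B"
    by (subst Max_le_iff) auto
  with False show ?thesis by (simp add: bisim_op_def)
qed (use assms in \<open>simp add: bisim_op_def\<close>)

lemma bisim_op_mono:
  assumes "0 \<le> \<gamma>" "\<And>x y. f x y \<le> g x y"
  shows "bisim_op P R \<gamma> f s s' \<le> bisim_op P R \<gamma> g s s'"
  using bisim_op_le_add[of \<gamma> 0 f g] assms by simp

lemma contracting_bisim_op:
  assumes "0 \<le> \<gamma>"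
  shows "contracting \<gamma> (bisim_op P R \<gamma>)"
  unfolding contracting_def
proof (intro allI)
  fix f g :: "'a \<Rightarrow> 'a \<Rightarrow> real" and s s'
  let ?M = "sup_norm (\<lambda>x y. f x y - g x y)"
  have "f x y \<le> g x y + ?M" "g x y \<le> f x y + ?M" for x y
    using abs_le_sup_norm[of "\<lambda>x y. f x y - g x y" x y] by linarith+
  then have "bisim_op P R \<gamma> f s s' \<le> bisim_op P R \<gamma> g s s' + \<gamma> * ?M"
    "bisim_op P R \<gamma> g s s' \<le> bisim_op P R \<gamma> f s s' + \<gamma> * ?M"
    using assms sup_norm_nonneg by (blast intro: bisim_op_le_add)+
  then show "\<bar>bisim_op P R \<gamma> f s s' - bisim_op P R \<gamma> g s s'\<bar> \<le> \<gamma> * ?M" by linarith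
qed

lemma bisim_op_flip: "bisim_op P R \<gamma> (\<lambda>x y. f y x) s s' = bisim_op P R \<gamma> f s' s"
  by (simp add: bisim_op_def W1_flip[of f] abs_minus_commute)

lemma bisim_op_zero: "bisim_op P R \<gamma> (\<lambda>x y. 0) = reward_metric R"
  by (intro ext) (simp add: bisim_op_def reward_metric_def W1_zero)

lemma reward_metric_nonneg: "0 \<le> reward_metric R s s'"
proof -
  have "\<bar>R s a - R s' a\<bar> \<le> reward_metric R s s'" for a
    unfolding reward_metric_def by (rule Max_ge) auto
  then show ?thesis using abs_ge_zero order_trans by blast
qed

text \<open>Monotonicity against the zero function, whose image is
  \<open>reward_metric R\<close>.\<close>

lemma bisim_op_nonneg:
  assumes "0 \<le> \<gamma>" "\<And>x y. 0 \<le> f x y"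
  shows "reward_metric R s s' \<le> bisim_op P R \<gamma> f s s'"
  using bisim_op_mono[of \<gamma> "\<lambda>x y. 0" f] assms by (simp add: bisim_op_zero)

lemma pair_function_reward_metric: "pair_function (reward_metric R)"
  by (simp add: pair_function_def reward_metric_def abs_minus_commute)

section \<open>The restricted operator and its iteration\<close>

text \<open>One step of the restricted iteration as an operator; for \<open>C = UNIV\<close> it is
  \<open>bisim_op\<close> itself.\<close>

definition restricted_op ::
  "('s::finite \<Rightarrow> 'a::finite \<Rightarrow> 's pmf) \<Rightarrow> ('s \<Rightarrow> 'a \<Rightarrow> real) \<Rightarrow> real
    \<Rightarrow> 's set set \<Rightarrow> ('s \<Rightarrow> 's \<Rightarrow> real) \<Rightarrow> ('s \<Rightarrow> 's \<Rightarrow> real) \<Rightarrow> 's \<Rightarrow> 's \<Rightarrow> real" where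
  "restricted_op P R \<gamma> C d0 f s s' = (if {s, s'} \<in> C then bisim_op P R \<gamma> f s s' else d0 s s')"

lemma contracting_restricted_op:
  assumes "0 \<le> \<gamma>"
  shows "contracting \<gamma> (restricted_op P R \<gamma> C d0)"
  using contractingD[OF contracting_bisim_op[OF assms]] assms
  by (auto simp: contracting_def restricted_op_def sup_norm_nonneg)

text \<open>Membership of \<open>{s, s'}\<close> in \<open>C\<close> ignores order and
  \<open>d0\<close> is symmetric, so the flip of a fixed point is again a fixed point; uniqueness
  makes the two equal. On the diagonal both branches of the operator give 0.\<close>

lemma pair_function_restricted_fixpoint:
  assumes \<gamma>: "0 \<le> \<gamma>" "\<gamma> < 1" and d0: "pair_function d0"
    and g: "restricted_op P R \<gamma> C d0 g = g"
  shows "pair_function g"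
proof -
  have "restricted_op P R \<gamma> C d0 (\<lambda>x y. g y x) s s' = g s' s" for s s'
  proof -
    have "restricted_op P R \<gamma> C d0 (\<lambda>x y. g y x) s s' = restricted_op P R \<gamma> C d0 g s' s"
      using d0 by (simp add: restricted_op_def bisim_op_flip[of P R \<gamma> g] insert_commute
            pair_function_def)
    then show ?thesis using g by simp
  qed
  then have "(\<lambda>x y. g y x) = g"
    by (intro contracting_fixpoint_unique[OF contracting_restricted_op[OF \<gamma>(1)] \<gamma>(2) _ g] ext)
  then have sym: "g s s' = g s' s" for s s' by metis
  have "restricted_op P R \<gamma> C d0 g s s = 0" for s
    using d0 by (simp add: restricted_op_def bisim_op_def pair_function_def)
  with sym g show ?thesis by (simp add: pair_function_def)
qed

lemma restricted_solution_iff: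
  assumes "0 \<le> \<gamma>" "\<gamma> < 1" "pair_function d0"
  shows "restricted_solution P R \<gamma> C d0 g \<longleftrightarrow> restricted_op P R \<gamma> C d0 g = g"
proof
  assume "restricted_solution P R \<gamma> C d0 g"
  then show "restricted_op P R \<gamma> C d0 g = g"
    by (auto simp: restricted_solution_def restricted_op_def fun_eq_iff)
next
  assume g: "restricted_op P R \<gamma> C d0 g = g"
  then have "pair_function g" using assms by (blast intro: pair_function_restricted_fixpoint)
  then show "restricted_solution P R \<gamma> C d0 g"
    using fun_cong[OF fun_cong[OF g]] unfolding restricted_solution_def restricted_op_def
    by (metis (full_types))
qed

lemma restricted_iter_converges:
  assumes \<gamma>: "0 \<le> \<gamma>" "\<gamma> < 1"
  shows "restricted_op P R \<gamma> C d0 (restricted_limit P R \<gamma> C d0) = restricted_limit P R \<gamma> C d0"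
    and "(\<lambda>t. restricted_iter P R \<gamma> C d0 t s s') \<longlonglongrightarrow> restricted_limit P R \<gamma> C d0 s s'"
proof -
  have step: "restricted_iter P R \<gamma> C d0 (Suc t) = restricted_op P R \<gamma> C d0 (restricted_iter P R \<gamma> C d0 t)"
    for t by (simp add: restricted_op_def fun_eq_iff)
  obtain g where g: "restricted_op P R \<gamma> C d0 g = g"
    and lim: "\<And>s s'. (\<lambda>t. restricted_iter P R \<gamma> C d0 t s s') \<longlonglongrightarrow> g s s'"
    using contracting_iterates_converge[OF contracting_restricted_op[OF \<gamma>(1)] \<gamma>,
        where f = "restricted_iter P R \<gamma> C d0", OF step] by blast
  have "restricted_limit P R \<gamma> C d0 = g"
    by (intro ext) (simp add: restricted_limit_def limI[OF lim])
  with g lim show "restricted_op P R \<gamma> C d0 (restricted_limit P R \<gamma> C d0)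
      = restricted_limit P R \<gamma> C d0"
    "(\<lambda>t. restricted_iter P R \<gamma> C d0 t s s') \<longlonglongrightarrow> restricted_limit P R \<gamma> C d0 s s'"
    by simp_all
qed

section \<open>The bisimulation metric\<close>

text \<open>Resolves the definite description in \<open>bisim_metric\<close>. Iterating from 0
  yields the fixed point together with its nonnegativity, since every iterate is
  nonnegative.\<close>

lemma bisim_metric_props:
  assumes \<gamma>: "0 \<le> \<gamma>" "\<gamma> < 1"
  shows bisim_metric_pair_function: "pair_function (bisim_metric P R \<gamma>)"
    and bisim_metric_fixpoint: "bisim_op P R \<gamma> (bisim_metric P R \<gamma>) = bisim_metric P R \<gamma>"
    and bisim_metric_nonneg: "0 \<le> bisim_metric P R \<gamma> s s'"
proof -
  define f where "f t = (bisim_op P R \<gamma> ^^ t) (\<lambda>x y. 0)" for t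
  have step: "f (Suc t) = bisim_op P R \<gamma> (f t)" for t by (simp add: f_def)
  obtain d where d: "bisim_op P R \<gamma> d = d" and lim: "\<And>x y. (\<lambda>t. f t x y) \<longlonglongrightarrow> d x y"
    using contracting_iterates_converge[OF contracting_bisim_op[OF \<gamma>(1)] \<gamma>, of f, OF step]
    by blast
  have "0 \<le> f t x y" for t x y
  proof (induction t arbitrary: x y)
    case (Suc t)
    have "0 \<le> bisim_op P R \<gamma> (f t) x y"
      using order_trans[OF reward_metric_nonneg bisim_op_nonneg[OF \<gamma>(1) Suc]] .
    then show ?case by (simp add: f_def)
  qed (simp add: f_def)
  then have nonneg: "0 \<le> d x y" for x y using lim by (blast intro: LIMSEQ_le_const)
  \<comment> \<open>Taking \<open>C = UNIV\<close> lets the symmetry result for restricted fixed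
    points apply to the unrestricted one.\<close>
  have "restricted_op P R \<gamma> UNIV (\<lambda>x y. 0) d = d" using d by (simp add: restricted_op_def fun_eq_iff)
  then have "pair_function d"
    by (rule pair_function_restricted_fixpoint[OF \<gamma>, rotated]) (simp add: pair_function_def)
  with d have "bisim_metric P R \<gamma> = d"
    unfolding bisim_metric_def
    using contracting_fixpoint_unique[OF contracting_bisim_op[OF \<gamma>(1)] \<gamma>(2)]
    by (intro the_equality) blast+
  with d nonneg \<open>pair_function d\<close> show "pair_function (bisim_metric P R \<gamma>)"
    "bisim_op P R \<gamma> (bisim_metric P R \<gamma>) = bisim_metric P R \<gamma>" "0 \<le> bisim_metric P R \<gamma> s s'"
    by simp_all
qed

section \<open>The two standard starting functions\<close>

lemma admissible_start_zero:
  assumes "0 \<le> \<gamma>" "\<gamma> < 1"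
  shows "admissible_start P R \<gamma> C (\<lambda>s s'. 0)"
  using bisim_metric_nonneg[OF assms, of P R]
  by (simp add: admissible_start_def pair_function_def bisim_op_zero reward_metric_nonneg)

text \<open>With \<open>T\<close> for \<open>bisim_op P R \<gamma>\<close>, any nonnegative
  \<open>f\<close> satisfies \<open>reward_metric R \<le> T f\<close>. Taking \<open>f\<close> to be
  the bisimulation metric gives the upper bound, and taking \<open>f\<close> to be the reward metric
  gives the sub-solution property.\<close>

lemma admissible_start_reward_metric:
  assumes "0 \<le> \<gamma>" "\<gamma> < 1"
  shows "admissible_start P R \<gamma> C (reward_metric R)"
proof -
  have "reward_metric R s s' \<le> bisim_metric P R \<gamma> s s'" for s s'
    using bisim_op_nonneg[of \<gamma> "bisim_metric P R \<gamma>" R s s' P]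
      bisim_metric_nonneg[OF assms, of P R]
    by (simp add: bisim_metric_fixpoint[OF assms] assms(1))
  then show ?thesis
    using assms by (simp add: admissible_start_def pair_function_reward_metric reward_metric_nonneg
        bisim_op_nonneg)
qed

section \<open>The gap off \<open>C\<close> and the error identity\<close>

lemma max_gap_off_set:
  "{d s s' - d0 s s' | s s'. s \<noteq> s' \<and> {s, s'} \<notin> C}
    = (\<lambda>(s, s'). d s s' - d0 s s') ` {(s, s'). s \<noteq> s' \<and> {s, s'} \<notin> C}"
  by auto

lemma gap_le_max_gap_off:
  "s \<noteq> s' \<Longrightarrow> {s, s'} \<notin> C \<Longrightarrow> d s s' - d0 s s' \<le> max_gap_off C d d0"
  by (auto simp: max_gap_off_def Let_def max_gap_off_set intro!: Max_ge)

lemma max_gap_off_cases: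
  obtains "max_gap_off C d d0 = 0"
  | s s' where "s \<noteq> s'" "{s, s'} \<notin> C" "max_gap_off C d d0 = d s s' - d0 s s'"
proof (cases "{d s s' - d0 s s' | s s'. s \<noteq> s' \<and> {s, s'} \<notin> C} = {}")
  case True
  then have "max_gap_off C d d0 = 0" unfolding max_gap_off_def Let_def by simp
  then show ?thesis by (rule that(1))
next
  case False
  then have "max_gap_off C d d0 \<in> {d s s' - d0 s s' | s s'. s \<noteq> s' \<and> {s, s'} \<notin> C}"
    using Max_in[OF _ False] by (simp only: max_gap_off_def Let_def if_False max_gap_off_set) simp
  then show ?thesis using that(2) by blast
qed

lemma sup_norm_restricted_limit:
  assumes \<gamma>: "0 \<le> \<gamma>" "\<gamma> < 1" and d0: "pair_function d0"
    and le: "\<And>s s'. d0 s s' \<le> bisim_metric P R \<gamma> s s'"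
  shows "sup_norm (\<lambda>s s'. restricted_limit P R \<gamma> C d0 s s' - bisim_metric P R \<gamma> s s')
    = max_gap_off C (bisim_metric P R \<gamma>) d0"
proof (rule antisym)
  let ?g = "restricted_limit P R \<gamma> C d0" and ?d = "bisim_metric P R \<gamma>"
  let ?M = "sup_norm (\<lambda>s s'. ?g s s' - ?d s s')" and ?\<rho> = "max_gap_off C ?d d0"
  note g = restricted_iter_converges(1)[OF \<gamma>, of P R C d0]
  have on: "?g s s' = bisim_op P R \<gamma> ?g s s'" if "{s, s'} \<in> C" for s s'
    using that fun_cong[OF fun_cong[OF g], of s s'] by (simp add: restricted_op_def)
  have off: "?g s s' = d0 s s'" if "{s, s'} \<notin> C" for s s'
    using that fun_cong[OF fun_cong[OF g], of s s'] by (simp add: restricted_op_def)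
  have \<rho>: "0 \<le> ?\<rho>" by (rule max_gap_off_cases[of C ?d d0]) (use le in auto)
  \<comment> \<open>A pair attaining \<open>\<rho>\<close> lies off \<open>C\<close>, where the
    limit equals \<open>d0\<close>, so its gap is one of the values bounded by the norm.\<close>
  show "?\<rho> \<le> ?M"
  proof (rule max_gap_off_cases[of C ?d d0])
    fix s s' assume "{s, s'} \<notin> C" "?\<rho> = ?d s s' - d0 s s'"
    then show "?\<rho> \<le> ?M"
      using off abs_le_sup_norm[of "\<lambda>s s'. ?g s s' - ?d s s'" s s'] by fastforce
  qed (simp add: sup_norm_nonneg)
  have "?M \<le> max ?\<rho> (\<gamma> * ?M)"
  proof (rule sup_norm_le)
    fix s s'
    \<comment> \<open>The diagonal off \<open>C\<close> needs its own case because
      \<open>max_gap_off\<close> ranges over distinct states; both functions vanish there and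
      \<open>0 \<le> \<rho>\<close> suffices.\<close>
    consider "{s, s'} \<in> C" | "s = s'" "{s, s'} \<notin> C" | "s \<noteq> s'" "{s, s'} \<notin> C" by blast
    then show "\<bar>?g s s' - ?d s s'\<bar> \<le> max ?\<rho> (\<gamma> * ?M)"
    proof cases
      case 1
      then have "\<bar>?g s s' - ?d s s'\<bar> \<le> \<gamma> * ?M"
        using contractingD[OF contracting_bisim_op[OF \<gamma>(1)], of P R ?g s s' ?d] on[OF 1]
        by (simp add: bisim_metric_fixpoint[OF \<gamma>])
      then show ?thesis by simp
    next
      case 2
      then show ?thesis
        using off d0 bisim_metric_pair_function[OF \<gamma>, of P R] \<rho> by (simp add: pair_function_def)
    next
      case 3
      then have "\<bar>?g s s' - ?d s s'\<bar> = ?d s s' - d0 s s'" using off le[of s s'] by simp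
      then show ?thesis using gap_le_max_gap_off[OF 3, of ?d d0] by simp
    qed
  qed
  \<comment> \<open>If \<open>\<rho> < M\<close>, then \<open>M\<close> is positive and
    \<open>\<gamma> * M < M\<close>, so both terms of the maximum would be below
    \<open>M\<close>.\<close>
  moreover have "\<gamma> * ?M < ?M" if "?\<rho> < ?M" using that \<rho> \<gamma> by simp
  ultimately show "?M \<le> ?\<rho>" by linarith
qed

theorem corollary3:
  fixes P :: "'s::finite \<Rightarrow> 'a::finite \<Rightarrow> 's pmf"
    and R :: "'s \<Rightarrow> 'a \<Rightarrow> real"
    and L \<gamma> :: real
    and C :: "'s set set"
    and d0 :: "'s \<Rightarrow> 's \<Rightarrow> real"
  assumes "is_mdp R L \<gamma>"
    and "C \<subseteq> state_pairs"
    and "admissible_start P R \<gamma> C d0"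
  shows "(\<forall>s s'. (\<lambda>t. restricted_iter P R \<gamma> C d0 t s s') \<longlonglongrightarrow> restricted_limit P R \<gamma> C d0 s s') \<and>
         (\<forall>g. restricted_solution P R \<gamma> C d0 g \<longleftrightarrow> g = restricted_limit P R \<gamma> C d0) \<and>
         sup_norm (\<lambda>s s'. restricted_limit P R \<gamma> C d0 s s' - bisim_metric P R \<gamma> s s')
           = max_gap_off C (bisim_metric P R \<gamma>) d0 \<and>
         admissible_start P R \<gamma> C (\<lambda>s s'. 0) \<and>
         admissible_start P R \<gamma> C (reward_metric R)"
proof -
  have \<gamma>: "0 \<le> \<gamma>" "\<gamma> < 1" using assms(1) by (auto simp: is_mdp_def)
  have d0: "pair_function d0" and le: "\<And>s s'. d0 s s' \<le> bisim_metric P R \<gamma> s s'"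
    using assms(3) by (auto simp: admissible_start_def)
  note lim = restricted_iter_converges[OF \<gamma>, of P R C d0]
  have "restricted_solution P R \<gamma> C d0 g \<longleftrightarrow> g = restricted_limit P R \<gamma> C d0" for g
    unfolding restricted_solution_iff[OF \<gamma> d0]
    using contracting_fixpoint_unique[OF contracting_restricted_op[OF \<gamma>(1)] \<gamma>(2) _ lim(1)] lim(1)
    by blast
  then show ?thesis
    using lim(2) sup_norm_restricted_limit[OF \<gamma> d0 le] admissible_start_zero[OF \<gamma>, of P R C]
      admissible_start_reward_metric[OF \<gamma>, of P R C] by simp
qed

end
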